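(* Let $n\in\mathbb{N}$ with $n\geq 5$. The following is a complete list up to (anti-)isomorphism of representatives of nilpotent semigroups of order $n$ and coclass $1$: \begin{itemize} \item $H_k = \langle u,v \mid u^{n-1}=u^n,\ uv=u^k,\ vu=u^k,\ v^2=u^{2k-2}\rangle$, for $2\leq k\leq n-1$; \item $J_k = \langle u,v \mid u^{n-1}=u^n,\ uv=u^k,\ vu=u^k,\ v^2=u^{n-2}\rangle$, for $n/2< k\leq n-1$; \item $X = \langle u,v \mid u^{n-1}=u^n,\ uv=u^{n/2},\ vu=u^{n/2},\ v^2=u^{n-1}\rangle$, if $n\equiv 0 \mod 2$; \item $N_1 = \langle u,v \mid u^{n-1}=u^n,\ uv=u^{n-1},\ vu=u^{n-2},\ v^2=u^{n-2}\rangle$; \item $N_2 = \langle u,v \mid u^{n-1}=u^n,\ uv=u^{n-1},\ vu=u^{n-2},\ v^2=u^{n-1}\rangle$. \end{itemize} All semigroups in the list, except $N_1$ and $N_2$, are self-dual.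
   Context: A semigroup $S$ is nilpotent if there exists $c\in\mathbb{N}_0$ with $|S^{c+1}|=1$, where $S^k$ denotes the set of all products of $k$ elements of $S$; the least such $c$ is the class of $S$. The coclass of a finite nilpotent semigroup $S$ of class $c$ is $|S|-1-c$. The dual of a semigroup is the semigroup on the same set with reversed multiplication. Two semigroups are anti-isomorphic if one is isomorphic to the dual of the other; a semigroup is self-dual if it is isomorphic to its dual. "(Anti-)isomorphic" means "isomorphic or anti-isomorphic", and "up to (anti-)isomorphism" means "up to isomorphism or anti-isomorphism". A complete list up to (anti-)isomorphism of representatives of semigroups with some property is a list of semigroups having that property such that every semigroup with the property is (anti-)isomorphic to exactly one member of the list. All presentations are semigroup presentations. *)

theory Defs
  imports Main
begin

section \<open>Semigroups on a carrier set\<close>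

record 'a sgp =
  carrier :: "'a set"
  mult :: "'a \<Rightarrow> 'a \<Rightarrow> 'a"

definition is_semigroup :: "'a sgp \<Rightarrow> bool" where
  "is_semigroup S \<longleftrightarrow>
     (\<forall>x\<in>carrier S. \<forall>y\<in>carrier S. mult S x y \<in> carrier S) \<and>
     (\<forall>x\<in>carrier S. \<forall>y\<in>carrier S. \<forall>z\<in>carrier S.
        mult S (mult S x y) z = mult S x (mult S y z))"

definition isomorphic :: "'a sgp \<Rightarrow> 'b sgp \<Rightarrow> bool" where
  "isomorphic S T \<longleftrightarrow>
     (\<exists>h. bij_betw h (carrier S) (carrier T) \<and>
          (\<forall>x\<in>carrier S. \<forall>y\<in>carrier S. h (mult S x y) = mult T (h x) (h y)))"

definition dual :: "'a sgp \<Rightarrow> 'a sgp" where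
  "dual S = \<lparr>carrier = carrier S, mult = (\<lambda>x y. mult S y x)\<rparr>"

definition anti_isomorphic :: "'a sgp \<Rightarrow> 'b sgp \<Rightarrow> bool" where
  "anti_isomorphic S T \<longleftrightarrow> isomorphic S (dual T)"

definition iso_or_anti_iso :: "'a sgp \<Rightarrow> 'b sgp \<Rightarrow> bool" where
  "iso_or_anti_iso S T \<longleftrightarrow> isomorphic S T \<or> anti_isomorphic S T"

definition self_dual :: "'a sgp \<Rightarrow> bool" where
  "self_dual S \<longleftrightarrow> isomorphic S (dual S)"


section \<open>Nilpotency, class and coclass\<close>

text \<open>The set of all products of \<open>k\<close> elements, meaningful for \<open>k \<ge> 1\<close>
  (it is empty for \<open>k = 0\<close>).\<close>

definition products :: "'a sgp \<Rightarrow> nat \<Rightarrow> 'a set" where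
  "products S k =
     {foldl (mult S) x xs | x xs. set (x # xs) \<subseteq> carrier S \<and> length (x # xs) = k}"

definition nilpotent :: "'a sgp \<Rightarrow> bool" where
  "nilpotent S \<longleftrightarrow> is_semigroup S \<and> (\<exists>c. card (products S (c + 1)) = 1)"

definition nilpotency_class :: "'a sgp \<Rightarrow> nat" where
  "nilpotency_class S = (LEAST c. card (products S (c + 1)) = 1)"

definition coclass :: "'a sgp \<Rightarrow> int" where
  "coclass S = int (card (carrier S)) - 1 - int (nilpotency_class S)"

definition nilpotent_of_order_coclass :: "nat \<Rightarrow> int \<Rightarrow> 'a sgp \<Rightarrow> bool" where
  "nilpotent_of_order_coclass n r S \<longleftrightarrow>
     nilpotent S \<and> finite (carrier S) \<and> card (carrier S) = n \<and> coclass S = r"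


section \<open>Semigroup presentations\<close>

text \<open>The free semigroup on the type \<open>'g\<close> consists of the nonempty words over \<open>'g\<close>.
  A relation is a pair of nonempty words; \<open>pres_cong R\<close> is the least congruence
  on the free semigroup that contains \<open>R\<close>.\<close>

inductive pres_cong :: "('g list \<times> 'g list) set \<Rightarrow> 'g list \<Rightarrow> 'g list \<Rightarrow> bool"
  for R :: "('g list \<times> 'g list) set" where
  rel: "(p, q) \<in> R \<Longrightarrow> p \<noteq> [] \<Longrightarrow> q \<noteq> [] \<Longrightarrow> pres_cong R p q"
| refl: "w \<noteq> [] \<Longrightarrow> pres_cong R w w"
| sym: "pres_cong R p q \<Longrightarrow> pres_cong R q p"
| trans: "pres_cong R p q \<Longrightarrow> pres_cong R q w \<Longrightarrow> pres_cong R p w"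
| mult: "pres_cong R p q \<Longrightarrow> pres_cong R p' q' \<Longrightarrow> pres_cong R (p @ p') (q @ q')"

definition presented :: "('g list \<times> 'g list) set \<Rightarrow> 'g list set sgp" where
  "presented R =
     \<lparr>carrier = {w. w \<noteq> []} // {(p, q). pres_cong R p q},
      mult = (\<lambda>C D. \<Union>p\<in>C. \<Union>q\<in>D. {w. pres_cong R (p @ q) w})\<rparr>"


section \<open>The semigroups in the list\<close>

datatype gen = u | v

text \<open>\<open>pres n a b c\<close> is
  \<open>\<langle>u, v | u\<^sup>n\<^sup>-\<^sup>1 = u\<^sup>n, uv = u\<^sup>a, vu = u\<^sup>b, v\<^sup>2 = u\<^sup>c\<rangle>\<close>.\<close>

definition pres :: "nat \<Rightarrow> nat \<Rightarrow> nat \<Rightarrow> nat \<Rightarrow> gen list set sgp" where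
  "pres n a b c = presented
     {(replicate (n - 1) u, replicate n u),
      ([u, v], replicate a u),
      ([v, u], replicate b u),
      ([v, v], replicate c u)}"

text \<open>The list is indexed by labels rather than given as a set of semigroups, so that
  \<^emph>\<open>exactly one member\<close> also excludes repetitions in the list.\<close>

datatype label = H nat | J nat | X | N1 | N2

definition labels :: "nat \<Rightarrow> label set" where
  "labels n = {H k | k. 2 \<le> k \<and> k \<le> n - 1} \<union> {J k | k. n < 2 * k \<and> k \<le> n - 1} \<union>
     (if even n then {X} else {}) \<union> {N1, N2}"

primrec list_member :: "nat \<Rightarrow> label \<Rightarrow> gen list set sgp" where
  "list_member n (H k) = pres n k k (2 * k - 2)"
| "list_member n (J k) = pres n k k (n - 2)"
| "list_member n X = pres n (n div 2) (n div 2) (n - 1)"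
| "list_member n N1 = pres n (n - 1) (n - 2) (n - 2)"
| "list_member n N2 = pres n (n - 1) (n - 2) (n - 1)"

hide_const (open) u v H J X N1 N2

text \<open>\<open>complete_list n r I F ty\<close>: the family \<open>F\<close> indexed by \<open>I\<close> is a complete list up to
  (anti-)isomorphism of representatives of nilpotent semigroups of order \<open>n\<close> and coclass
  \<open>r\<close>, where the semigroups to be classified have elements of type \<open>'a\<close>. The type \<open>'a\<close>
  must be left arbitrary in a theorem for the classification to cover all semigroups;
  the instance \<open>'a = 'b\<close> shows that the members of the list are pairwise
  not (anti-)isomorphic.\<close>

definition complete_list ::
  "nat \<Rightarrow> int \<Rightarrow> 'i set \<Rightarrow> ('i \<Rightarrow> 'b sgp) \<Rightarrow> 'a itself \<Rightarrow> bool" where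
  "complete_list n r I F (_ :: 'a itself) \<longleftrightarrow>
     (\<forall>i\<in>I. nilpotent_of_order_coclass n r (F i)) \<and>
     (\<forall>S :: 'a sgp. nilpotent_of_order_coclass n r S \<longrightarrow>
        (\<exists>!i. i \<in> I \<and> iso_or_anti_iso S (F i)))"

end

theory Submission
  imports Defs
begin

text \<open>In a nilpotent semigroup of order \<open>n\<close> and class \<open>n - 2\<close> the chain
  \<open>S \<supset> S\<^sup>2 \<supset> \<dots> \<supset> S\<^sup>n\<^sup>-\<^sup>1 = {0}\<close> drops by \<open>2\<close> elements once and by one element otherwise.
  The large drop is the first one, as otherwise \<open>S\<close> would be generated by one element. Hence
  \<open>S\<close> has two generators, one of which, \<open>u\<close>, satisfies \<open>u\<^sup>2 \<notin> S\<^sup>3\<close>; then \<open>S\<^sup>2\<close> consists of powers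
  of \<open>u\<close>, and \<open>S\<close> is determined by the exponents in \<open>uv = u\<^sup>a\<close>, \<open>vu = u\<^sup>b\<close>, \<open>v\<^sup>2 = u\<^sup>c\<close>.
  Up to exchanging \<open>a\<close> and \<open>b\<close>, that is, up to passing to the dual, associativity leaves exactly
  the listed triples, and \<open>(a, b, c)\<close> is an isomorphism invariant.\<close>

section \<open>Isomorphisms and products\<close>

lemma isomorphic_refl: "isomorphic S S"
  unfolding isomorphic_def by (rule exI[of _ id]) simp

lemma isomorphic_trans:
  assumes "isomorphic S T" "isomorphic T U"
  shows "isomorphic S U"
proof -
  obtain h k where h: "bij_betw h (carrier S) (carrier T)"
      "\<And>x y. x \<in> carrier S \<Longrightarrow> y \<in> carrier S \<Longrightarrow> h (mult S x y) = mult T (h x) (h y)"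
    and k: "bij_betw k (carrier T) (carrier U)"
      "\<And>x y. x \<in> carrier T \<Longrightarrow> y \<in> carrier T \<Longrightarrow> k (mult T x y) = mult U (k x) (k y)"
    using assms unfolding isomorphic_def by blast
  have "bij_betw (k \<circ> h) (carrier S) (carrier U)"
    using h(1) k(1) by (rule bij_betw_trans)
  moreover have "h x \<in> carrier T" if "x \<in> carrier S" for x
    using that h(1) bij_betwE by blast
  ultimately show ?thesis
    unfolding isomorphic_def by (intro exI[of _ "k \<circ> h"]) (simp add: h(2) k(2))
qed

lemma isomorphic_sym:
  assumes "is_semigroup S" "isomorphic S T"
  shows "isomorphic T S"
proof -
  obtain h where h: "bij_betw h (carrier S) (carrier T)"
      "\<And>x y. x \<in> carrier S \<Longrightarrow> y \<in> carrier S \<Longrightarrow> h (mult S x y) = mult T (h x) (h y)"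
    using assms(2) unfolding isomorphic_def by blast
  let ?g = "inv_into (carrier S) h"
  have g: "bij_betw ?g (carrier T) (carrier S)"
    using h(1) by (rule bij_betw_inv_into)
  moreover have "?g (mult T x y) = mult S (?g x) (?g y)"
    if "x \<in> carrier T" "y \<in> carrier T" for x y
  proof -
    have gS: "?g x \<in> carrier S" "?g y \<in> carrier S"
      using that g bij_betwE by blast+
    then have "mult S (?g x) (?g y) \<in> carrier S"
      using assms(1) by (simp add: is_semigroup_def)
    moreover have "h (mult S (?g x) (?g y)) = mult T x y"
      using that h gS by (simp add: bij_betw_inv_into_right[OF h(1)])
    ultimately show ?thesis
      using h(1) bij_betw_inv_into_left by metis
  qed
  ultimately show ?thesis
    unfolding isomorphic_def by blast
qed

lemma isomorphic_dual: "isomorphic S T \<Longrightarrow> isomorphic (dual S) (dual T)"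
  by (auto simp: isomorphic_def dual_def)

lemma is_semigroup_dual: "is_semigroup S \<Longrightarrow> is_semigroup (dual S)"
  by (auto simp: is_semigroup_def dual_def)

lemma is_semigroup_isomorphic:
  assumes "is_semigroup S" "isomorphic S T"
  shows "is_semigroup T"
proof -
  obtain h where h: "h ` carrier S = carrier T"
      "\<And>x y. x \<in> carrier S \<Longrightarrow> y \<in> carrier S \<Longrightarrow> mult T (h x) (h y) = h (mult S x y)"
    using assms(2) unfolding isomorphic_def bij_betw_def by metis
  show ?thesis
    using assms(1) unfolding is_semigroup_def h(1)[symmetric] by (simp add: h(2))
qed

section \<open>Sets of k-fold products and their behaviour under isomorphism\<close>

lemma products_1: "products S (Suc 0) = carrier S"
proof -
  have "x \<in> products S (Suc 0)" if "x \<in> carrier S" for x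
    unfolding products_def using that by (intro CollectI exI[of _ x] exI[of _ "[]"]) simp
  then show ?thesis
    by (auto simp: products_def)
qed

text \<open>\<open>foldl\<close> nests to the left, so the last factor can be split off directly.
  The case \<open>k = 0\<close> is excluded because \<open>products S 0\<close> is empty.\<close>

lemma products_Suc:
  assumes "0 < k"
  shows "products S (Suc k) = {mult S x y | x y. x \<in> products S k \<and> y \<in> carrier S}"
proof (intro equalityI subsetI)
  fix z assume "z \<in> products S (Suc k)"
  then obtain x xs where xs: "z = foldl (mult S) x xs" "set (x # xs) \<subseteq> carrier S" "length xs = k"
    unfolding products_def by auto
  with assms obtain ys y where "xs = ys @ [y]"
    by (metis length_greater_0_conv rev_exhaust)
  with xs show "z \<in> {mult S x y | x y. x \<in> products S k \<and> y \<in> carrier S}"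
    by (auto simp: products_def)
next
  fix z assume "z \<in> {mult S x y | x y. x \<in> products S k \<and> y \<in> carrier S}"
  then obtain x xs y where *: "z = mult S (foldl (mult S) x xs) y" "set (x # xs) \<subseteq> carrier S"
      "length (x # xs) = k" "y \<in> carrier S"
    unfolding products_def by blast
  then show "z \<in> products S (Suc k)"
    unfolding products_def by (intro CollectI exI[of _ x] exI[of _ "xs @ [y]"]) auto
qed

lemma products_subset_carrier:
  assumes "is_semigroup S" "0 < k"
  shows "products S k \<subseteq> carrier S"
  using assms(2)
proof (induction k rule: nat_induct_non_zero)
  case 1
  then show ?case by (simp add: products_1)
next
  case (Suc k)
  then show ?case
    using assms(1) by (auto simp: products_Suc is_semigroup_def)
qed

lemma products_image:
  assumes "is_semigroup S" "h ` carrier S = carrier T"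
    and h: "\<And>x y. x \<in> carrier S \<Longrightarrow> y \<in> carrier S \<Longrightarrow> h (mult S x y) = mult T (h x) (h y)"
    and "0 < k"
  shows "products T k = h ` products S k"
  using assms(4)
proof (induction k rule: nat_induct_non_zero)
  case 1
  then show ?case by (simp add: products_1 assms(2))
next
  case (Suc k)
  have P: "x \<in> carrier S" if "x \<in> products S k" for x
    using products_subset_carrier[OF assms(1) Suc.hyps] that by blast
  have "products T (Suc k) = {mult T x y | x y. x \<in> h ` products S k \<and> y \<in> h ` carrier S}"
    by (simp add: products_Suc Suc assms(2))
  also have "\<dots> = h ` products S (Suc k)"
    by (auto simp: products_Suc Suc.hyps image_iff) (metis P h)+
  finally show ?case .
qed

lemma card_products_isomorphic:
  assumes "is_semigroup S" "isomorphic S T" "0 < k"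
  shows "card (products T k) = card (products S k)"
proof -
  obtain h where h: "inj_on h (carrier S)" "h ` carrier S = carrier T"
      "\<And>x y. x \<in> carrier S \<Longrightarrow> y \<in> carrier S \<Longrightarrow> h (mult S x y) = mult T (h x) (h y)"
    using assms(2) unfolding isomorphic_def bij_betw_def by metis
  have "inj_on h (products S k)"
    using h(1) products_subset_carrier[OF assms(1,3)] inj_on_subset by blast
  then show ?thesis
    using products_image[OF assms(1) h(2,3) assms(3)] by (simp add: card_image)
qed

lemma nilpotent_of_order_coclass_isomorphic:
  assumes "nilpotent_of_order_coclass n r S" "isomorphic S T"
  shows "nilpotent_of_order_coclass n r T"
proof -
  have S: "is_semigroup S"
    using assms(1) by (simp add: nilpotent_of_order_coclass_def nilpotent_def)
  obtain h where "bij_betw h (carrier S) (carrier T)"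
    using assms(2) unfolding isomorphic_def by metis
  then have "card (carrier T) = card (carrier S)" "finite (carrier T) = finite (carrier S)"
    using bij_betw_same_card bij_betw_finite by metis+
  moreover have "card (products T (c + 1)) = card (products S (c + 1))" for c
    using card_products_isomorphic[OF S assms(2)] by simp
  ultimately show ?thesis
    using assms(1) is_semigroup_isomorphic[OF S assms(2)]
    by (simp add: nilpotent_of_order_coclass_def nilpotent_def nilpotency_class_def coclass_def)
qed

section \<open>Normal forms\<close>

text \<open>The nilpotent semigroup with two generators \<open>u\<close>, \<open>v\<close> in which \<open>u\<^sup>n\<^sup>-\<^sup>1 = 0\<close>, \<open>uv = u\<^sup>a\<close>,
  \<open>vu = u\<^sup>b\<close>, \<open>v\<^sup>2 = u\<^sup>c\<close>: the number \<open>i > 0\<close> encodes \<open>u\<^sup>i\<close>, and \<open>0\<close> encodes \<open>v\<close>.\<close>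

definition nf_mult :: "nat \<Rightarrow> nat \<Rightarrow> nat \<Rightarrow> nat \<Rightarrow> nat \<Rightarrow> nat \<Rightarrow> nat" where
  "nf_mult n a b c i j = min (n - 1)
     (if i = 0 then if j = 0 then c else b + j - 1 else if j = 0 then a + i - 1 else i + j)"

definition nf_sgp :: "nat \<Rightarrow> nat \<Rightarrow> nat \<Rightarrow> nat \<Rightarrow> nat sgp" where
  "nf_sgp n a b c = \<lparr>carrier = {..<n}, mult = nf_mult n a b c\<rparr>"

lemma nf_sgp_simps [simp]:
  "carrier (nf_sgp n a b c) = {..<n}" "mult (nf_sgp n a b c) = nf_mult n a b c"
  by (simp_all add: nf_sgp_def)

lemma dual_nf_sgp: "dual (nf_sgp n a b c) = nf_sgp n b a c"
  by (auto simp: dual_def nf_sgp_def nf_mult_def fun_eq_iff add.commute)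

text \<open>With exponents capped at \<open>n - 1\<close>, associativity amounts to u^(a+1) =
  u^(b+1) and u^(2a-1) = u^(c+1) = u^(2b-1); the three alternatives are the solutions. There is no
  upper bound on \<open>c\<close>, because the exponent 2k-2 in H_k can exceed
  \<open>n - 1\<close>.\<close>

definition consistent :: "nat \<Rightarrow> nat \<Rightarrow> nat \<Rightarrow> nat \<Rightarrow> bool" where
  "consistent n a b c \<longleftrightarrow> 5 \<le> n \<and> 2 \<le> a \<and> a < n \<and> 2 \<le> b \<and> b < n \<and> 2 \<le> c \<and>
     (a = b \<and> c = 2 * a - 2 \<or> a = b \<and> n \<le> 2 * a \<and> n \<le> c + 2 \<or>
      n \<le> a + 2 \<and> n \<le> b + 2 \<and> n \<le> c + 2)"

lemma consistent_bounds:
  assumes "consistent n a b c"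
  shows "5 \<le> n" "2 \<le> a" "a < n" "2 \<le> b" "b < n" "2 \<le> c"
  using assms by (auto simp: consistent_def)

lemma min_eq_min_iff: "min m x = min m y \<longleftrightarrow> x = y \<or> m \<le> x \<and> m \<le> y" for x y :: nat
  by (auto simp: min_def)

text \<open>Shifting \<open>a\<close> and \<open>b\<close> down by one removes the truncated
  subtractions. Once nested caps collapse, each of the eight choices of which factors are
  \<open>v\<close> is linear arithmetic.\<close>

lemma nf_mult_assoc:
  assumes "consistent n a b c"
  shows "nf_mult n a b c (nf_mult n a b c i j) k = nf_mult n a b c i (nf_mult n a b c j k)"
proof -
  note bounds = consistent_bounds[OF assms]
  define m where "m = n - 1"
  define a' where "a' = a - 1"
  define b' where "b' = b - 1"
  have n: "n = Suc m" and m: "0 < m" and a: "a = Suc a'" and b: "b = Suc b'"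
    and nz: "a' \<noteq> 0" "b' \<noteq> 0" "c \<noteq> 0"
    using bounds by (simp_all add: m_def a'_def b'_def)
  have nf: "nf_mult n a b c i j =
      min m (if i = 0 then if j = 0 then c else b' + j else if j = 0 then a' + i else i + j)" for i j
    by (simp add: nf_mult_def n a b)
  \<comment> \<open>Inner caps are absorbed by the outer one, and capping neither creates nor
    destroys the code \<open>0\<close> of \<open>v\<close>.\<close>
  have cap: "min m (f + min m x) = min m (f + x)" "min m (min m x + f) = min m (x + f)"
      "min m x = 0 \<longleftrightarrow> x = 0" for f x
    using m by (simp_all add: min_def)
  have "a' = b' \<and> c = 2 * a' \<or> a' = b' \<and> m \<le> 2 * a' + 1 \<and> m \<le> c + 1 \<or>
      m \<le> a' + 2 \<and> m \<le> b' + 2 \<and> m \<le> c + 1"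
    using assms by (auto simp: consistent_def n a b)
  then show ?thesis
    unfolding nf
    by (cases "i = 0"; cases "j = 0"; cases "k = 0";
        simp only: cap add_is_0 nz if_True if_False simp_thms min_eq_min_iff; use nz in linarith)
qed

lemma nf_mult_less: "0 < n \<Longrightarrow> nf_mult n a b c i j < n"
  by (auto simp: nf_mult_def)

lemma is_semigroup_nf_sgp: "consistent n a b c \<Longrightarrow> is_semigroup (nf_sgp n a b c)"
  by (auto simp: is_semigroup_def nf_mult_assoc nf_mult_less)

text \<open>Associativity is evaluated at the triples (u,v,u), (u,v,v) and (v,v,u) only; the
  resulting equations between capped exponents are then solved.\<close>

lemma consistent_if_assoc:
  assumes "is_semigroup (nf_sgp n a b c)" "5 \<le> n" "a \<in> {2..<n}" "b \<in> {2..<n}" "c \<in> {2..<n}"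
  shows "consistent n a b c"
proof -
  define m where "m = n - 1"
  have n: "n = Suc m"
    using assms(2) by (simp add: m_def)
  have *: "nf_mult n a b c (nf_mult n a b c i j) k = nf_mult n a b c i (nf_mult n a b c j k)"
    if "i < n" "j < n" "k < n" for i j k
    using assms(1) that by (simp add: is_semigroup_def)
  have min: "min m a = a" "min m b = b" "min m c = c"
    using assms(3-5) by (simp_all add: n)
  have pos: "0 < a" "0 < b" "0 < c" and m: "1 \<le> m" "min m 1 = 1"
    using assms(2-5) by (simp_all add: n)
  have "min m (a + 1) = min m (b + 1)"
    using *[of 1 0 1] assms(2) min(1,2) pos by (simp add: nf_mult_def n)
  moreover have "min m (2 * a - 1) = min m (c + 1)"
    using *[of 1 0 0] assms(2) min(1,3) pos by (simp add: nf_mult_def n mult_2)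
  moreover have "min m (c + 1) = min m (2 * b - 1)"
    using *[of 0 0 1] assms(2) min(2,3) pos by (simp add: nf_mult_def n mult_2)
  ultimately have "a = b \<or> m \<le> a + 1 \<and> m \<le> b + 1"
      "2 * a = c + 2 \<or> m + 1 \<le> 2 * a \<and> m \<le> c + 1"
    using pos unfolding min_eq_min_iff by linarith+
  \<comment> \<open>Since \<open>m \<ge> 4\<close>, the bound \<open>m \<le> a + 1\<close> gives
    \<open>m \<le> 2 * a - 1\<close>. This puts the case \<open>a \<noteq> b\<close> under the third
    alternative.\<close>
  moreover have "m \<le> c + 1" if "m \<le> a + 1" "2 * a = c + 2"
    using that pos assms(2-5) n by auto
  ultimately show ?thesis
    using assms(2-5) unfolding consistent_def n by auto
qed

section \<open>Class and isomorphism invariants of the normal forms\<close>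

lemma atLeastLessThan_subset_lessThan: "{m..<n::nat} \<subseteq> {..<n}"
  by auto

lemma products_nf_sgp:
  assumes "consistent n a b c" "2 \<le> k"
  shows "products (nf_sgp n a b c) k = {min (n - 1) k..<n}"
  using assms(2)
proof (induction k rule: dec_induct)
  case base
  have n: "5 \<le> n"
    using consistent_bounds[OF assms(1)] by simp
  have "{nf_mult n a b c i j | i j. i < n \<and> j < n} = {2..<n}"
  proof (intro equalityI subsetI)
    fix x assume "x \<in> {2..<n}"
    then show "x \<in> {nf_mult n a b c i j | i j. i < n \<and> j < n}"
      by (intro CollectI exI[of _ "x - 1"] exI[of _ 1]) (auto simp: nf_mult_def)
  next
    fix x assume "x \<in> {nf_mult n a b c i j | i j. i < n \<and> j < n}"
    then show "x \<in> {2..<n}"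
      using consistent_bounds[OF assms(1)] nf_mult_less[of n a b c] by (auto simp: nf_mult_def)
  qed
  moreover have "min (n - 1) 2 = 2"
    using n by (simp add: min_def)
  ultimately show ?case
    using products_Suc[of "Suc 0" "nf_sgp n a b c"] by (simp add: products_1 numeral_2_eq_2)
next
  case (step k)
  have n: "5 \<le> n"
    using consistent_bounds[OF assms(1)] by simp
  have "{nf_mult n a b c i j | i j. i \<in> {min (n - 1) k..<n} \<and> j \<in> {..<n}}
      = {min (n - 1) (Suc k)..<n}"
  proof (intro equalityI subsetI)
    fix x assume "x \<in> {min (n - 1) (Suc k)..<n}"
    then show "x \<in> {nf_mult n a b c i j | i j. i \<in> {min (n - 1) k..<n} \<and> j \<in> {..<n}}"
      using step.hyps n
      \<comment> \<open>The zero \<open>n - 1\<close> is its own product with \<open>u\<close>;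
        every other \<open>x\<close> is the product of \<open>x - 1\<close> and
        \<open>u\<close>.\<close>
      by (intro CollectI exI[of _ "if x = n - 1 then x else x - 1"] exI[of _ 1])
        (auto simp: nf_mult_def)
  next
    fix x assume "x \<in> {nf_mult n a b c i j | i j. i \<in> {min (n - 1) k..<n} \<and> j \<in> {..<n}}"
    then obtain i j where "x = nf_mult n a b c i j" "min (n - 1) k \<le> i"
      by auto
    then show "x \<in> {min (n - 1) (Suc k)..<n}"
      using consistent_bounds[OF assms(1)] step.hyps by (auto simp: nf_mult_def)
  qed
  then show ?case
    using step by (simp add: products_Suc)
qed

lemma nilpotent_of_order_coclass_nf_sgp:
  assumes "consistent n a b c"
  shows "nilpotent_of_order_coclass n 1 (nf_sgp n a b c)"
proof -
  let ?S = "nf_sgp n a b c"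
  have n: "5 \<le> n"
    using consistent_bounds[OF assms] by simp
  \<comment> \<open>The case \<open>d = 0\<close> is separate because the chain drops by two
    elements from the carrier to the set of 2-fold products.\<close>
  have *: "card (products ?S (d + 1)) = 1 \<longleftrightarrow> n - 2 \<le> d" for d
  proof (cases "d = 0")
    case True
    then show ?thesis using n by (simp add: products_1)
  next
    case False
    then show ?thesis using n by (auto simp: products_nf_sgp[OF assms] min_def)
  qed
  have "nilpotency_class ?S = n - 2"
    unfolding nilpotency_class_def * by (rule Least_equality) auto
  moreover have "nilpotent ?S"
    unfolding nilpotent_def * using is_semigroup_nf_sgp[OF assms] by blast
  ultimately show ?thesis
    using n by (simp add: nilpotent_of_order_coclass_def coclass_def)
qed

text \<open>An isomorphism preserves the sets of \<open>k\<close>-fold products, hence maps \<open>{u, v}\<close> to itself and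
  fixes \<open>u\<^sup>2\<close>; if it exchanges \<open>u\<close> and \<open>v\<close>, then \<open>c = 2\<close> on both sides, which forces
  \<open>a = b = 2\<close>.\<close>

lemma isomorphic_nf_sgp_imp_eq:
  assumes M: "consistent n a b c" and M': "consistent n a' b' c'"
    and "isomorphic (nf_sgp n a b c) (nf_sgp n a' b' c')"
  shows "a = a' \<and> b = b' \<and> min (n - 1) c = min (n - 1) c'"
proof -
  let ?S = "nf_sgp n a b c" and ?T = "nf_sgp n a' b' c'"
  have n: "5 \<le> n"
    using consistent_bounds[OF M] by simp
  obtain h where bij: "bij_betw h {..<n} {..<n}"
    and h: "\<And>i j. i < n \<Longrightarrow> j < n \<Longrightarrow> h (nf_mult n a b c i j) = nf_mult n a' b' c' (h i) (h j)"
    using assms(3) unfolding isomorphic_def by auto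
  have img: "h ` {..<n} = {..<n}" and inj: "inj_on h {..<n}"
    using bij by (auto simp: bij_betw_def)
  have himg: "h ` {min (n - 1) k..<n} = {min (n - 1) k..<n}" if "2 \<le> k" for k
    using products_image[OF is_semigroup_nf_sgp[OF M], of h ?T k] img h that
    by (simp add: products_nf_sgp[OF M] products_nf_sgp[OF M'])
  have "min (n - 1) 2 = 2" "min (n - 1) 3 = 3"
    using n by linarith+
  then have himg2: "h ` {2..<n} = {2..<n}" and himg3: "h ` {3..<n} = {3..<n}"
    using himg[of 2] himg[of 3] by simp_all
  have "h ` ({..<n} - {2..<n}) = {..<n} - {2..<n}"
    using inj_on_image_set_diff[OF inj, of "{..<n}" "{2..<n}"] himg2 img
    by (metis Diff_subset atLeastLessThan_subset_lessThan)
  moreover have "{..<n} - {2..<n} = {0, 1}"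
    using n by auto
  ultimately have h01: "{h 0, h 1} = {0, 1}"
    by simp
  have "h ` ({2..<n} - {3..<n}) = {2..<n} - {3..<n}"
    using inj_on_image_set_diff[OF inj, of "{2..<n}" "{3..<n}"] himg2 himg3
    by (simp add: subset_iff)
  moreover have "{2..<n} - {3..<n} = {2}"
    using n by auto
  ultimately have h2: "h 2 = 2"
    by simp
  show ?thesis
  proof (cases "h 1 = 1")
    case True
    then have h0: "h 0 = 0"
      using h01 by (auto simp: doubleton_eq_iff)
    \<comment> \<open>Once \<open>h\<close> fixes \<open>u\<close>, it fixes every power of
      \<open>u\<close>, so the images of uv, vu and v^2 show that the exponents agree.\<close>
    have id: "h i = i" if "0 < i" "i < n" for i
      using that
    proof (induction i rule: nat_induct_non_zero)
      case 1
      then show ?case using True by simp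
    next
      case (Suc i)
      then show ?case
        using h[of i 1] True by (simp add: nf_mult_def)
    qed
    note bounds = consistent_bounds[OF M] consistent_bounds[OF M']
    have cap: "min (n - 1) a = a" "min (n - 1) a' = a'" "min (n - 1) b = b" "min (n - 1) b' = b'"
        "0 < min (n - 1) c" "min (n - 1) c < n"
      using bounds by linarith+
    have "h a = a'"
      using h[of 1 0] h0 True n cap(1,2) by (simp add: nf_mult_def)
    moreover have "h b = b'"
      using h[of 0 1] h0 True n cap(3,4) by (simp add: nf_mult_def)
    moreover have "h (min (n - 1) c) = min (n - 1) c'"
      using h[of 0 0] h0 n by (simp add: nf_mult_def)
    ultimately show ?thesis
      using id[of a] id[of b] id[of "min (n - 1) c"] bounds cap(5,6) by simp
  next
    case False
    then have "h 1 = 0" "h 0 = 1"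
      using h01 by (auto simp: doubleton_eq_iff)
    then have "min (n - 1) c' = 2" "h (min (n - 1) c) = 2"
      using h[of 1 1] h[of 0 0] h2 n by (simp_all add: nf_mult_def numeral_2_eq_2)
    moreover from this(2) have "min (n - 1) c = 2"
      using inj_onD[OF inj, of "min (n - 1) c" 2] h2 n by simp
    ultimately have "c = 2" "c' = 2"
      using n by linarith+
    \<comment> \<open>For \<open>c = 2\<close> and \<open>n \<ge> 5\<close> the alternatives with
      \<open>n \<le> c + 2\<close> fail, leaving \<open>a = b\<close> and
      \<open>2 * a - 2 = 2\<close>.\<close>
    then show ?thesis
      using M M' by (auto simp: consistent_def)
  qed
qed

section \<open>The presented semigroups\<close>

text \<open>One-letter words have their own clause because there is no identity element; the value
  on the empty word is a dummy.\<close>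

fun nf_eval :: "nat \<Rightarrow> nat \<Rightarrow> nat \<Rightarrow> nat \<Rightarrow> gen list \<Rightarrow> nat" where
  "nf_eval n a b c [] = 0"
| "nf_eval n a b c [g] = (if g = gen.u then 1 else 0)"
| "nf_eval n a b c (g # w) = nf_mult n a b c (if g = gen.u then 1 else 0) (nf_eval n a b c w)"

lemma nf_eval_append:
  assumes "consistent n a b c" "p \<noteq> []" "q \<noteq> []"
  shows "nf_eval n a b c (p @ q) = nf_mult n a b c (nf_eval n a b c p) (nf_eval n a b c q)"
  using assms(2)
proof (induction p rule: list_nonempty_induct)
  case (single g)
  with assms(3) show ?case by (cases q) auto
next
  case (cons g p)
  then obtain g' p' where "p = g' # p'"
    by (cases p) auto
  with cons show ?case
    by (simp add: nf_mult_assoc[OF assms(1)])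
qed

lemma nf_eval_less:
  assumes "1 < n" "w \<noteq> []"
  shows "nf_eval n a b c w < n"
  using assms by (cases "(n, a, b, c, w)" rule: nf_eval.cases) (auto simp: nf_mult_less)

lemma nf_eval_replicate:
  assumes "1 < n" "0 < k"
  shows "nf_eval n a b c (replicate k gen.u) = min (n - 1) k"
  using assms(2)
proof (induction k rule: nat_induct_non_zero)
  case 1
  then show ?case using assms(1) by simp
next
  case (Suc k)
  then obtain m where "k = Suc m"
    by (cases k) auto
  with Suc assms(1) show ?case
    by (auto simp: nf_mult_def)
qed

definition pres_rels :: "nat \<Rightarrow> nat \<Rightarrow> nat \<Rightarrow> nat \<Rightarrow> (gen list \<times> gen list) set" where
  "pres_rels n a b c =
     {(replicate (n - 1) gen.u, replicate n gen.u),
      ([gen.u, gen.v], replicate a gen.u),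
      ([gen.v, gen.u], replicate b gen.u),
      ([gen.v, gen.v], replicate c gen.u)}"

lemma pres_cong_nonempty: "pres_cong R p q \<Longrightarrow> p \<noteq> [] \<and> q \<noteq> []"
  by (induction rule: pres_cong.induct) auto

text \<open>Soundness of the normal forms: evaluation is a homomorphism satisfying the four
  relations, hence constant on congruence classes.\<close>

lemma pres_cong_eval:
  assumes "consistent n a b c" "pres_cong (pres_rels n a b c) p q"
  shows "nf_eval n a b c p = nf_eval n a b c q"
  using assms(2)
proof (induction rule: pres_cong.induct)
  case (rel p q)
  then show ?case
    using consistent_bounds[OF assms(1)]
    by (auto simp: pres_rels_def nf_eval_replicate nf_mult_def)
next
  case (mult p q p' q')
  then show ?case
    using pres_cong_nonempty[OF mult.hyps(1)] pres_cong_nonempty[OF mult.hyps(2)]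
    by (simp add: nf_eval_append[OF assms(1)])
qed auto

definition nf_word :: "nat \<Rightarrow> gen list" where
  "nf_word i = (if i = 0 then [gen.v] else replicate i gen.u)"

lemma nf_word_nonempty: "nf_word i \<noteq> []"
  by (simp add: nf_word_def)

lemma nf_eval_nf_word: "i < n \<Longrightarrow> 1 < n \<Longrightarrow> nf_eval n a b c (nf_word i) = i"
  by (simp add: nf_word_def nf_eval_replicate)

text \<open>Repeated use of u^(n-1) = u^n collapses all powers from u^(n-1) on.\<close>

lemma pres_cong_power_min:
  assumes "1 < n" "0 < m"
  shows "pres_cong (pres_rels n a b c) (replicate m gen.u) (nf_word (min (n - 1) m))"
  using assms(2)
proof (induction m rule: nat_induct_non_zero)
  case 1
  then show ?case using assms(1) by (simp add: nf_word_def pres_cong.refl)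
next
  case (Suc m)
  let ?R = "pres_rels n a b c"
  show ?case
  proof (cases "Suc m < n")
    case True
    then show ?thesis by (simp add: nf_word_def pres_cong.refl flip: replicate_Suc)
  next
    case False
    then have "pres_cong ?R (replicate m gen.u) (replicate (n - 1) gen.u)"
      using Suc assms(1) by (simp add: nf_word_def split: if_splits)
    then have "pres_cong ?R ([gen.u] @ replicate m gen.u) ([gen.u] @ replicate (n - 1) gen.u)"
      by (intro pres_cong.mult pres_cong.refl) auto
    then have "pres_cong ?R (replicate (Suc m) gen.u) (replicate n gen.u)"
      using assms(1) by (simp flip: replicate_Suc)
    moreover have "pres_cong ?R (replicate (n - 1) gen.u) (replicate n gen.u)"
      using assms(1) by (intro pres_cong.rel) (auto simp: pres_rels_def)
    ultimately show ?thesis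
      using False assms(1) pres_cong.sym pres_cong.trans by (simp add: nf_word_def) blast
  qed
qed

text \<open>Completeness of the normal forms: a word is reduced from the right, each letter in front
  of a normal word being merged with it into a power of \<open>u\<close>, which is then
  capped.\<close>

lemma pres_cong_nf_word:
  assumes "consistent n a b c" "w \<noteq> []"
  shows "pres_cong (pres_rels n a b c) w (nf_word (nf_eval n a b c w))"
  using assms(2)
proof (induction w rule: list_nonempty_induct)
  case (single g)
  then show ?case
    by (cases g) (simp_all add: nf_word_def pres_cong.refl)
next
  case (cons g w)
  let ?R = "pres_rels n a b c"
  define i where "i = nf_eval n a b c w"
  have n: "1 < n" "0 < a" "0 < b" "0 < c"
    using consistent_bounds[OF assms(1)] by simp_all
  have gw: "pres_cong ?R ([g] @ w) ([g] @ nf_word i)"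
    unfolding i_def using cons.IH by (intro pres_cong.mult pres_cong.refl) auto
  have "\<exists>m>0. pres_cong ?R ([g] @ nf_word i) (replicate m gen.u) \<and>
      nf_eval n a b c (g # w) = min (n - 1) m"
  proof -
    have e: "nf_eval n a b c (g # w) = nf_mult n a b c (if g = gen.u then 1 else 0) i"
      using cons.hyps by (cases w) (auto simp: i_def)
    show ?thesis
    proof (cases "i = 0")
      case True
      have "pres_cong ?R [g, gen.v] (replicate (if g = gen.u then a else c) gen.u)"
        using n by (intro pres_cong.rel, cases g) (auto simp: pres_rels_def)
      then show ?thesis
        using True n e
        by (intro exI[of _ "if g = gen.u then a else c"]) (simp add: nf_word_def nf_mult_def)
    next
      case i: False
      show ?thesis
      proof (cases g)
        case u
        then show ?thesis
          using i e pres_cong.refl[of "replicate (Suc i) gen.u" ?R]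
          by (intro exI[of _ "Suc i"]) (simp add: nf_word_def nf_mult_def)
      next
        case v
        have vu: "pres_cong ?R [gen.v, gen.u] (replicate b gen.u)"
          using n by (intro pres_cong.rel) (auto simp: pres_rels_def)
        have "pres_cong ?R ([gen.v] @ nf_word i) (replicate (b + i - 1) gen.u)"
        \<comment> \<open>For \<open>i = 1\<close> the remaining power u^(i-1) is the empty word, to
          which reflexivity of the congruence does not apply.\<close>
        proof (cases "i = 1")
          case True
          then show ?thesis using vu by (simp add: nf_word_def)
        next
          case False
          then have "pres_cong ?R ([gen.v, gen.u] @ replicate (i - 1) gen.u)
              (replicate b gen.u @ replicate (i - 1) gen.u)"
            using i by (intro pres_cong.mult vu pres_cong.refl) auto
          moreover have "[gen.v, gen.u] @ replicate (i - 1) gen.u = [gen.v] @ nf_word i"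
            using i by (cases i) (auto simp: nf_word_def)
          moreover have "b + (i - 1) = b + i - 1"
            using i by simp
          ultimately show ?thesis
            by (simp flip: replicate_add)
        qed
        then show ?thesis
          using i e v n by (intro exI[of _ "b + i - 1"]) (simp add: nf_mult_def)
      qed
    qed
  qed
  then obtain m where "0 < m" "pres_cong ?R ([g] @ nf_word i) (replicate m gen.u)"
      "nf_eval n a b c (g # w) = min (n - 1) m"
    by blast
  then have "pres_cong ?R ([g] @ w) (nf_word (nf_eval n a b c (g # w)))"
    using pres_cong.trans[OF gw pres_cong.trans] pres_cong_power_min[OF n(1), of m a b c] by simp
  then show ?case
    by simp
qed

lemma pres_cong_iff:
  assumes "consistent n a b c"
  shows "pres_cong (pres_rels n a b c) p q \<longleftrightarrow>
    p \<noteq> [] \<and> q \<noteq> [] \<and> nf_eval n a b c p = nf_eval n a b c q"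
    (is "?L \<longleftrightarrow> ?R")
proof
  show "?L \<Longrightarrow> ?R"
    using pres_cong_nonempty pres_cong_eval[OF assms] by blast
next
  assume R: ?R
  then have "pres_cong (pres_rels n a b c) q (nf_word (nf_eval n a b c p))"
    using pres_cong_nf_word[OF assms, of q] by simp
  then show ?L
    using pres_cong_nf_word[OF assms, of p] R pres_cong.sym pres_cong.trans by blast
qed

lemma isomorphic_nf_sgp_pres:
  assumes "consistent n a b c"
  shows "isomorphic (nf_sgp n a b c) (pres n a b c)"
proof -
  let ?e = "nf_eval n a b c"
  have n: "1 < n"
    using consistent_bounds[OF assms] by simp
  \<comment> \<open>By \<open>pres_cong_iff\<close>, the words with a common value form a congruence
    class; sending the value to this class is the isomorphism.\<close>
  define cls where "cls i = {w. w \<noteq> [] \<and> ?e w = i}" for i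
  have cls_word: "nf_word i \<in> cls i" if "i < n" for i
    using that n by (simp add: cls_def nf_word_nonempty nf_eval_nf_word)
  have pres: "pres n a b c = presented (pres_rels n a b c)"
    by (simp add: pres_def pres_rels_def)
  have "carrier (pres n a b c) = (\<lambda>w. cls (?e w)) ` {w. w \<noteq> []}"
  proof -
    have "{(p, q). pres_cong (pres_rels n a b c) p q} `` {w} = cls (?e w)" if "w \<noteq> []" for w
      using that by (auto simp: pres_cong_iff[OF assms] cls_def)
    moreover have "carrier (pres n a b c) =
        (\<lambda>w. {(p, q). pres_cong (pres_rels n a b c) p q} `` {w}) ` {w. w \<noteq> []}"
      by (auto simp: pres presented_def quotient_def)
    ultimately show ?thesis
      by simp
  qed
  also have "\<dots> = cls ` {..<n}"
  proof -
    have "?e ` {w. w \<noteq> []} = {..<n}"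
    proof (intro equalityI subsetI)
      fix i assume "i \<in> {..<n}"
      then show "i \<in> ?e ` {w. w \<noteq> []}"
        using cls_word[of i] by (intro image_eqI[of _ _ "nf_word i"]) (simp_all add: cls_def)
    qed (use nf_eval_less[OF n] in auto)
    then show ?thesis
      by (metis image_image)
  qed
  finally have img: "cls ` {..<n} = carrier (pres n a b c)"
    by simp
  have "inj_on cls {..<n}"
  proof (rule inj_onI)
    fix i j assume "i \<in> {..<n}" "j \<in> {..<n}" "cls i = cls j"
    then have "nf_word i \<in> cls i" "nf_word i \<in> cls j"
      using cls_word[of i] by auto
    then show "i = j"
      by (simp add: cls_def)
  qed
  moreover have "cls (nf_mult n a b c i j) = mult (pres n a b c) (cls i) (cls j)"
    if "i < n" "j < n" for i j
  proof -
    \<comment> \<open>Every concatenation lands in the same class, so the union is over a constant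
      family; its index sets are nonempty, as they contain normal words.\<close>
    have "mult (pres n a b c) (cls i) (cls j)
        = (\<Union>p\<in>cls i. \<Union>q\<in>cls j. cls (nf_mult n a b c i j))"
      by (auto simp: pres presented_def pres_cong_iff[OF assms] cls_def nf_eval_append[OF assms])
    then show ?thesis
      using cls_word[OF that(1)] cls_word[OF that(2)] by auto
  qed
  ultimately show ?thesis
    unfolding isomorphic_def bij_betw_def using img by (intro exI[of _ cls]) auto
qed

section \<open>Semigroups of coclass 1\<close>

locale carrier_semigroup =
  fixes S :: "'a sgp" (structure)
  assumes sgp: "is_semigroup S"
begin

abbreviation times (infixl "\<cdot>" 70) where "x \<cdot> y \<equiv> mult S x y"

abbreviation P where "P \<equiv> products S"

lemma assoc:
  "x \<in> carrier S \<Longrightarrow> y \<in> carrier S \<Longrightarrow> z \<in> carrier S \<Longrightarrow> x \<cdot> y \<cdot> z = x \<cdot> (y \<cdot> z)"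
  using sgp by (simp add: is_semigroup_def)

lemma products_carrier: "0 < k \<Longrightarrow> x \<in> P k \<Longrightarrow> x \<in> carrier S"
  using products_subset_carrier[OF sgp] by blast

lemma products_2: "P 2 = {x \<cdot> y | x y. x \<in> carrier S \<and> y \<in> carrier S}"
  using products_Suc[of "Suc 0" S] by (simp only: products_1 numeral_2_eq_2 zero_less_Suc simp_thms)

lemma mult_products:
  assumes "0 < i" "0 < j" "x \<in> P i" "y \<in> P j"
  shows "x \<cdot> y \<in> P (i + j)"
  using assms(2,4)
proof (induction j arbitrary: y rule: nat_induct_non_zero)
  case 1
  then show ?case
    using assms(1,3) by (auto simp: products_1 products_Suc)
next
  case (Suc j)
  then obtain w z where y: "y = w \<cdot> z" "w \<in> P j" "z \<in> carrier S"
    by (auto simp: products_Suc)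
  then have "x \<cdot> y = x \<cdot> w \<cdot> z"
    using assms products_carrier Suc.hyps by (simp add: assoc)
  then show ?case
    using Suc.IH[OF y(2)] y(3) assms(1) by (auto simp: products_Suc)
qed

lemma mult_products_carrier:
  "0 < k \<Longrightarrow> x \<in> P k \<Longrightarrow> y \<in> carrier S \<Longrightarrow> x \<cdot> y \<in> P (Suc k)"
  by (auto simp: products_Suc)

lemma carrier_mult_products:
  "0 < k \<Longrightarrow> x \<in> carrier S \<Longrightarrow> y \<in> P k \<Longrightarrow> x \<cdot> y \<in> P (Suc k)"
  using mult_products[of "Suc 0" k x y] by (simp add: products_1)

lemma products_Suc_subset: "0 < k \<Longrightarrow> P (Suc k) \<subseteq> P k"
proof (induction k rule: nat_induct_non_zero)
  case 1
  then show ?case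
    using products_subset_carrier[OF sgp] by (simp add: products_1)
next
  case (Suc k)
  have "x \<cdot> y \<in> P (Suc k)" if "x \<in> P (Suc k)" "y \<in> carrier S" for x y
    using that Suc mult_products_carrier by blast
  then show ?case
    by (subst products_Suc) auto
qed

lemma products_antimono:
  assumes "i \<le> j" "0 < i"
  shows "P j \<subseteq> P i"
  using assms(1)
proof (induction j rule: dec_induct)
  case (step j)
  then show ?case
    using products_Suc_subset[of j] assms(2) by auto
qed simp

text \<open>S^(k+1) is computed from S^k, so a single repetition makes the chain constant.\<close>

lemma products_stable:
  assumes "P (Suc k) = P k" "0 < k" "k \<le> m"
  shows "P m = P k"
  using assms(3)
proof (induction m rule: dec_induct)
  case (step m)
  have "P (Suc m) = {x \<cdot> y | x y. x \<in> P m \<and> y \<in> carrier S}"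
    using step.hyps assms(2) by (intro products_Suc) simp
  also have "\<dots> = P (Suc k)"
    using step.IH assms(2) by (simp add: products_Suc)
  finally show ?case
    using assms(1) by simp
qed simp

text \<open>There is no identity element, so \<open>pow x 0\<close> is a dummy and only positive
  exponents are meaningful.\<close>

primrec pow :: "'a \<Rightarrow> nat \<Rightarrow> 'a" where
  "pow x 0 = x"
| "pow x (Suc k) = (if k = 0 then x else pow x k \<cdot> x)"

lemma pow_products:
  assumes "x \<in> carrier S" "0 < k"
  shows "pow x k \<in> P k"
  using assms(2)
proof (induction k rule: nat_induct_non_zero)
  case 1
  then show ?case using assms(1) by (simp add: products_1)
next
  case (Suc k)
  then show ?case
    using assms(1) by (auto simp: products_Suc)
qed

lemma pow_add:
  assumes "x \<in> carrier S" "0 < i" "0 < j"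
  shows "pow x i \<cdot> pow x j = pow x (i + j)"
  using assms(3)
proof (induction j rule: nat_induct_non_zero)
  case 1
  then show ?case using assms(2) by simp
next
  case (Suc j)
  have "pow x i \<in> carrier S" "pow x j \<in> carrier S"
    using assms Suc.hyps pow_products products_carrier by blast+
  then show ?case
    using Suc assms(1,2) by (simp flip: assoc)
qed

text \<open>An element of S^k outside S^(k+1) is x^k = x^(k-1) x. Multiplying by z and rebracketing
  brings in xz, which is x^2 or lies in S^3, so the result is x^(k+1) or lies in S^(k+2).\<close>

lemma products_subset_insert_pow:
  assumes "x \<in> carrier S" "P 2 \<subseteq> insert (x \<cdot> x) (P 3)" "2 \<le> k"
  shows "P k \<subseteq> insert (pow x k) (P (Suc k))"
  using assms(3)
proof (induction k rule: dec_induct)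
  case base
  then show ?case
    using assms(2) by (simp add: numeral_2_eq_2 numeral_3_eq_3)
next
  case (step k)
  have "y \<cdot> z \<in> insert (pow x (Suc k)) (P (Suc (Suc k)))" if "y \<in> P k" "z \<in> carrier S" for y z
  proof (cases "y \<in> P (Suc k)")
    case True
    then show ?thesis using that(2) mult_products_carrier by blast
  next
    case False
    with step.IH that(1) have "y = pow x k"
      by auto
    then have "y = pow x (k - 1) \<cdot> x"
      using step.hyps by (cases k) auto
    moreover have k: "pow x (k - 1) \<in> P (k - 1)"
      using pow_products[OF assms(1)] step.hyps by simp
    ultimately have eq: "y \<cdot> z = pow x (k - 1) \<cdot> (x \<cdot> z)"
      using assms(1) that(2) step.hyps products_carrier[OF _ k] by (simp add: assoc)
    have "x \<cdot> z \<in> P 2"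
      using products_2 assms(1) that(2) by blast
    with assms(2) consider "x \<cdot> z = pow x 2" | "x \<cdot> z \<in> P 3"
      by (auto simp: numeral_2_eq_2)
    then show ?thesis
    proof cases
      case 1
      then have "y \<cdot> z = pow x (k - 1 + 2)"
        using eq step.hyps pow_add[OF assms(1), of "k - 1" 2] by simp
      moreover have "k - 1 + 2 = Suc k"
        using step.hyps by simp
      ultimately show ?thesis by (simp del: pow.simps)
    next
      case 2
      have "k - 1 + 3 = Suc (Suc k)"
        using step.hyps by simp
      then show ?thesis
        using mult_products[OF _ _ k 2] eq step.hyps by simp
    qed
  qed
  then show ?case
    using step.hyps by (subst products_Suc) auto
qed

end

section \<open>Cardinalities along the chain of products, and reduction to normal form\<close>

locale coclass_1_semigroup = carrier_semigroup +
  fixes n :: nat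
  assumes n: "5 \<le> n"
    and nilp: "nilpotent_of_order_coclass n 1 S"
begin

lemma fin: "finite (carrier S)" and card_carrier: "card (carrier S) = n"
  using nilp by (simp_all add: nilpotent_of_order_coclass_def)

lemma finite_products: "0 < k \<Longrightarrow> finite (P k)"
  using fin products_subset_carrier[OF sgp] finite_subset by blast

lemma nilpotency_class: "nilpotency_class S = n - 2"
  using nilp n by (auto simp: nilpotent_of_order_coclass_def coclass_def)

lemma card_products_last: "card (P (n - 1)) = 1"
proof -
  have "\<exists>c. card (P (c + 1)) = 1"
    using nilp by (auto simp: nilpotent_of_order_coclass_def nilpotent_def)
  then have "card (P (nilpotency_class S + 1)) = 1"
    unfolding nilpotency_class_def by (rule LeastI_ex)
  moreover have "n - 2 + 1 = n - 1"
    using n by simp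
  ultimately show ?thesis
    by (simp add: nilpotency_class)
qed

text \<open>Equality would make the chain constant from S^k on, so S^k would already be the
  singleton S^(n-1), against the minimality of the class.\<close>

lemma products_strict:
  assumes "0 < k" "k < n - 1"
  shows "P (Suc k) \<subset> P k"
proof -
  have "card (P (k - 1 + 1)) \<noteq> 1"
    using assms nilpotency_class unfolding nilpotency_class_def by (intro not_less_Least) simp
  then have "P k \<noteq> P (n - 1)"
    using card_products_last assms by auto
  then show ?thesis
    using products_stable[of k "n - 1"] products_Suc_subset[of k] assms by auto
qed

lemma card_products_Suc_less:
  assumes "0 < k" "k < n - 1"
  shows "card (P (Suc k)) < card (P k)"
  using products_strict[OF assms] finite_products[OF assms(1)] by (rule psubset_card_mono[rotated])

lemma card_products_ge:
  assumes "0 < k" "k \<le> n - 1"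
  shows "n - k \<le> card (P k)"
  using assms(2)
proof (induction k rule: inc_induct)
  case base
  then show ?case
    using card_products_last n by simp
next
  case (step k)
  then show ?case
    using card_products_Suc_less[of k] assms(1) by linarith
qed

text \<open>Each step of the chain loses at most the element x^k; the count runs backwards from the
  singleton S^(n-1).\<close>

lemma card_products_le_chain:
  assumes "x \<in> carrier S" "P 2 \<subseteq> insert (x \<cdot> x) (P 3)" "2 \<le> k" "k \<le> n - 1"
  shows "card (P k) \<le> n - k"
  using assms(4,3)
proof (induction k rule: inc_induct)
  case base
  then show ?case
    using card_products_last n by simp
next
  case (step k)
  have "card (P k) \<le> card (insert (pow x k) (P (Suc k)))"
    using products_subset_insert_pow[OF assms(1,2) step.prems] finite_products by (simp add: card_mono)
  also have "\<dots> \<le> Suc (card (P (Suc k)))"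
    by (rule card_insert_le_m1) auto
  finally show ?case
    using step by simp
qed

text \<open>If only one element were indecomposable, \<open>S\<close> would consist of its powers, and the class
  of \<open>S\<close> would be \<open>n - 1\<close>.\<close>

lemma card_products_2: "card (P 2) = n - 2"
proof -
  have "card (P 2) < n"
    using card_products_Suc_less[of 1] n by (simp add: products_1 card_carrier numeral_2_eq_2)
  moreover have "card (P 2) \<noteq> n - 1"
  proof
    assume "card (P 2) = n - 1"
    have sub: "P 2 \<subseteq> carrier S"
      using products_subset_carrier[OF sgp] by simp
    have "card (carrier S - P 2) = 1"
      using \<open>card (P 2) = n - 1\<close> n sub by (simp add: card_Diff_subset finite_products card_carrier)
    then obtain x where x: "carrier S - P 2 = {x}"
      by (rule card_1_singletonE)
    \<comment> \<open>A product with a decomposable factor lies in S^3, so only the square of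
      \<open>x\<close> can lie outside, and the chain bound contradicts |S^2| = n - 1.\<close>
    have "y \<cdot> z \<in> insert (x \<cdot> x) (P 3)" if yz: "y \<in> carrier S" "z \<in> carrier S" for y z
    proof -
      consider "y \<in> P 2" | "z \<in> P 2" | "y = x" "z = x"
        using x yz by blast
      then show ?thesis
      proof cases
        case 1
        then show ?thesis
          using mult_products_carrier[of 2 y z] yz by simp
      next
        case 2
        then show ?thesis
          using carrier_mult_products[of 2 y z] yz by simp
      qed simp
    qed
    then have "P 2 \<subseteq> insert (x \<cdot> x) (P 3)"
      unfolding products_2 by blast
    then have "card (P 2) \<le> n - 2"
      using x n by (intro card_products_le_chain[of x]) auto
    then show False
      using \<open>card (P 2) = n - 1\<close> n by simp
  qed
  moreover have "n - 2 \<le> card (P 2)"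
    using card_products_ge[of 2] n by simp
  ultimately show ?thesis
    by linarith
qed

text \<open>From |S^2| = n - 2 to |S^(n-1)| = 1 there are n - 3 strict drops, so each is by exactly
  one element.\<close>

lemma card_products:
  assumes "2 \<le> k" "k \<le> n - 1"
  shows "card (P k) = n - k"
proof -
  have "card (P k) \<le> n - k"
    using assms
  proof (induction k rule: dec_induct)
    case base
    then show ?case by (simp add: card_products_2)
  next
    case (step k)
    then show ?case
      using card_products_Suc_less[of k] by simp
  qed
  then show ?thesis
    using card_products_ge[of k] assms by simp
qed

text \<open>Some product pqr lies outside S^4; its factors are generators, and pq = qr is the only
  element of S^2 outside S^3. If both generators had their squares in S^3, then r = p and pq = qp,
  so pqr = q(pp) would lie in S^4.\<close>

lemma ex_generators:
  obtains x y where "x \<noteq> y" "carrier S - P 2 = {x, y}" "P 2 \<subseteq> insert (x \<cdot> x) (P 3)"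
proof -
  have P3: "P 3 = {p \<cdot> q | p q. p \<in> P 2 \<and> q \<in> carrier S}"
    using products_Suc[of 2 S] by simp
  have sub: "P 2 \<subseteq> carrier S"
    using products_subset_carrier[OF sgp] by simp
  have "card (carrier S - P 2) = 2"
    using n sub by (simp add: card_Diff_subset finite_products card_carrier card_products)
  then obtain x y where xy: "carrier S - P 2 = {x, y}" "x \<noteq> y"
    by (auto simp: card_2_iff)
  have "P 3 \<subseteq> P 2" "P 4 \<subseteq> P 3"
    by (simp_all add: products_antimono)
  then have "card (P 2 - P 3) = 1"
    using n by (simp add: card_Diff_subset finite_products card_products)
  then obtain s where s: "P 2 - P 3 = {s}"
    by (rule card_1_singletonE)
  have s_eq: "p \<cdot> q = s" if "p \<in> carrier S" "q \<in> carrier S" "p \<cdot> q \<notin> P 3" for p q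
    using that s products_2 by blast
  have "P 3 \<noteq> P 4"
  proof -
    \<comment> \<open>Here \<open>n \<ge> 5\<close> matters: the chain still drops strictly after
      S^3.\<close>
    have "3 < n - 1"
      using n by linarith
    then show ?thesis
      using products_strict[of 3] by auto
  qed
  then obtain t where "t \<in> P 3" "t \<notin> P 4"
    using \<open>P 4 \<subseteq> P 3\<close> by blast
  then obtain p q r where pqr: "p \<in> carrier S" "q \<in> carrier S" "r \<in> carrier S" "p \<cdot> q \<cdot> r \<notin> P 4"
    unfolding P3 products_2 by blast
  have pq: "p \<cdot> q \<notin> P 3"
    using mult_products_carrier[of 3 "p \<cdot> q" r] pqr by auto
  have qr: "q \<cdot> r \<notin> P 3"
    using carrier_mult_products[of 3 p "q \<cdot> r"] pqr by (auto simp: assoc)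
  have "p \<notin> P 2" "q \<notin> P 2" "r \<notin> P 2"
    using mult_products_carrier[of 2 p q] carrier_mult_products[of 2 p q]
      carrier_mult_products[of 2 q r] pqr pq qr by auto
  then have gens: "p \<in> {x, y}" "q \<in> {x, y}" "r \<in> {x, y}"
    using xy(1) pqr by auto
  have "x \<cdot> x \<notin> P 3 \<or> y \<cdot> y \<notin> P 3"
  proof (rule ccontr)
    assume "\<not> ?thesis"
    then have "p \<noteq> q" "r = p" "p \<cdot> p \<in> P 3"
      using gens pq qr by auto
    moreover have "p \<cdot> q = q \<cdot> p"
      using s_eq pq qr pqr(1-3) \<open>r = p\<close> by metis
    ultimately have "p \<cdot> q \<cdot> r = q \<cdot> (p \<cdot> p)"
      using pqr by (simp add: assoc)
    then show False
      using carrier_mult_products[of 3 q "p \<cdot> p"] pqr \<open>p \<cdot> p \<in> P 3\<close> by auto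
  qed
  moreover have "P 2 \<subseteq> insert (w \<cdot> w) (P 3)" if "w \<in> {x, y}" "w \<cdot> w \<notin> P 3" for w
    using s_eq[of w w] that xy(1) s by auto
  ultimately show thesis
    using that[of x y] that[of y x] xy by (auto simp: insert_commute)
qed

text \<open>S^2 consists of the powers x^2, ..., x^(n-1), so \<open>y\<close> and the powers of
  \<open>x\<close> exhaust S, and the products xy, yx, yy supply the exponents.\<close>

lemma isomorphic_normal_form:
  obtains a b c where "consistent n a b c" "isomorphic (nf_sgp n a b c) S"
proof -
  obtain x y where xy: "x \<noteq> y" "carrier S - P 2 = {x, y}" "P 2 \<subseteq> insert (x \<cdot> x) (P 3)"
    by (rule ex_generators)
  then have x: "x \<in> carrier S" and y: "y \<in> carrier S"
    by auto
  note pow_P = pow_products[OF x]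
  have sub: "P 2 \<subseteq> pow x ` {2..<k} \<union> P k" if "2 \<le> k" for k
    using that
  proof (induction k rule: dec_induct)
    case (step k)
    have "P k \<subseteq> insert (pow x k) (P (Suc k))"
      using step.hyps by (intro products_subset_insert_pow x xy(3))
    moreover have "pow x ` {2..<Suc k} = insert (pow x k) (pow x ` {2..<k})"
      using step.hyps by (simp add: atLeastLessThanSuc del: pow.simps)
    ultimately show ?case
      using step.IH by auto
  qed simp
  have "P (n - 1) = {pow x (n - 1)}"
    using card_products_last pow_P[of "n - 1"] n by (auto simp: card_1_singleton_iff)
  \<comment> \<open>All powers from exponent \<open>n - 1\<close> on lie in the singleton
    S^(n-1).\<close>
  then have pow_cap: "pow x (min (n - 1) k) = pow x k" if "0 < k" for k
    using that pow_P[of k] products_antimono[of "n - 1" k] n by (cases "k \<le> n - 1") auto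
  have "{2..<n} = insert (n - 1) {2..<n - 1}"
    using n by auto
  then have P2: "P 2 = pow x ` {2..<n}"
  proof (intro equalityI)
    have "P 2 \<subseteq> pow x ` {2..<n - 1} \<union> P (n - 1)"
      using n by (intro sub) simp
    then show "P 2 \<subseteq> pow x ` {2..<n}"
      by (simp only: \<open>{2..<n} = insert (n - 1) {2..<n - 1}\<close> \<open>P (n - 1) = {pow x (n - 1)}\<close>) auto
    show "pow x ` {2..<n} \<subseteq> P 2"
    proof (intro image_subsetI)
      fix k assume "k \<in> {2..<n}"
      then show "pow x k \<in> P 2"
        using pow_P[of k] products_antimono[of 2 k] by auto
    qed
  qed
  define g where "g i = (if i = 0 then y else pow x i)" for i
  have "{..<n} = insert 0 (insert 1 {2..<n})"
    using n by auto
  then have "g ` {..<n} = insert (g 0) (insert (g 1) (g ` {2..<n}))"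
    by simp
  moreover have "g ` {2..<n} = P 2"
    unfolding P2 by (intro image_cong) (auto simp: g_def)
  moreover have "g 0 = y" "g 1 = x"
    by (simp_all add: g_def)
  ultimately have img: "g ` {..<n} = carrier S"
    using xy(2) products_subset_carrier[OF sgp, of 2] by auto
  \<comment> \<open>A surjection between two sets of \<open>n\<close> elements is injective.\<close>
  then have inj: "inj_on g {..<n}"
    by (intro eq_card_imp_inj_on) (simp_all add: card_carrier)
  have "p \<cdot> q \<in> pow x ` {2..<n}" if "p \<in> carrier S" "q \<in> carrier S" for p q
    using that P2 products_2 by blast
  then obtain a b c where abc: "a \<in> {2..<n}" "b \<in> {2..<n}" "c \<in> {2..<n}"
    and a: "x \<cdot> y = pow x a" and b: "y \<cdot> x = pow x b" and c: "y \<cdot> y = pow x c"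
    using x y by (meson imageE)
  have hom: "g (nf_mult n a b c i j) = g i \<cdot> g j" for i j
  proof -
    have pow_carrier: "pow x k \<in> carrier S" if "0 < k" for k
      using pow_P that products_carrier by blast
    have powl: "pow x j = x \<cdot> pow x (j - 1)" if "1 < j" for j
      using pow_add[OF x, of 1 "j - 1"] that by simp
    have powr: "pow x j = pow x (j - 1) \<cdot> x" if "1 < j" for j
      using pow_add[OF x, of "j - 1" 1] that by simp
    have g: "g (min (n - 1) k) = pow x k" if "0 < k" for k
    proof -
      have "min (n - 1) k \<noteq> 0"
        using that n by linarith
      then show ?thesis
        by (simp only: g_def if_False pow_cap[OF that])
    qed
    have "y \<cdot> pow x j = pow x (b + j - 1)" if "0 < j"
    proof (cases "j = 1")
      case False
      then have "y \<cdot> pow x j = y \<cdot> x \<cdot> pow x (j - 1)"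
        using that x y pow_carrier by (simp add: powl assoc)
      then show ?thesis
        using False that abc pow_add[OF x, of b "j - 1"] by (simp add: b)
    qed (simp add: b)
    moreover have "pow x i \<cdot> y = pow x (a + i - 1)" if "0 < i"
    proof (cases "i = 1")
      case False
      then have "pow x i \<cdot> y = pow x (i - 1) \<cdot> (x \<cdot> y)"
        using that x y pow_carrier by (simp add: powr assoc)
      then show ?thesis
        using False that abc pow_add[OF x, of "i - 1" a] by (simp add: a add.commute)
    qed (simp add: a)
    moreover have "pow x i \<cdot> pow x j = pow x (i + j)" if "0 < i" "0 < j"
      using pow_add[OF x that] .
    ultimately have "g i \<cdot> g j = pow x (if i = 0 then if j = 0 then c else b + j - 1
        else if j = 0 then a + i - 1 else i + j)"
      by (simp add: g_def c)
    moreover have "0 < (if i = 0 then if j = 0 then c else b + j - 1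
        else if j = 0 then a + i - 1 else i + j)"
      using abc by auto
    ultimately show ?thesis
      unfolding nf_mult_def by (simp only: g)
  qed
  have iso: "isomorphic (nf_sgp n a b c) S"
    unfolding isomorphic_def bij_betw_def using inj img hom by (intro exI[of _ g]) simp
  \<comment> \<open>Consistency of the exponents is not yet known, so associativity is pulled back
    from S along the injective \<open>g\<close>.\<close>
  have "is_semigroup (nf_sgp n a b c)"
  proof -
    have "nf_mult n a b c (nf_mult n a b c i j) k = nf_mult n a b c i (nf_mult n a b c j k)"
      if "i < n" "j < n" "k < n" for i j k
    proof (rule inj_onD[OF inj])
      have "g i \<in> carrier S" "g j \<in> carrier S" "g k \<in> carrier S"
        using img that by auto
      then show "g (nf_mult n a b c (nf_mult n a b c i j) k)
          = g (nf_mult n a b c i (nf_mult n a b c j k))"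
        by (simp add: hom assoc)
    qed (use n in \<open>simp_all add: nf_mult_less\<close>)
    then show ?thesis
      using n by (simp add: is_semigroup_def nf_mult_less)
  qed
  then show thesis
    using that iso consistent_if_assoc n abc by blast
qed

end

section \<open>The classification\<close>

lemma nf_sgp_cong: "min (n - 1) c = min (n - 1) c' \<Longrightarrow> nf_sgp n a b c = nf_sgp n a b c'"
  by (auto simp: nf_sgp_def nf_mult_def fun_eq_iff)

lemma consistent_swap: "consistent n a b c \<Longrightarrow> consistent n b a c"
  by (auto simp: consistent_def)

text \<open>Passing to the dual exchanges uv and vu, hence \<open>a\<close> and
  \<open>b\<close>.\<close>

lemma iso_or_anti_iso_pres_iff:
  assumes "consistent n a b c"
  shows "iso_or_anti_iso S (pres n a b c) \<longleftrightarrow>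
    isomorphic S (nf_sgp n a b c) \<or> isomorphic S (nf_sgp n b a c)"
proof -
  have iso: "isomorphic (nf_sgp n a b c) (pres n a b c)"
    by (rule isomorphic_nf_sgp_pres[OF assms])
  then have "isomorphic (nf_sgp n b a c) (dual (pres n a b c))"
    using isomorphic_dual dual_nf_sgp by metis
  then show ?thesis
    unfolding iso_or_anti_iso_def anti_isomorphic_def
    using iso isomorphic_trans isomorphic_sym is_semigroup_nf_sgp[OF assms]
      is_semigroup_nf_sgp[OF consistent_swap[OF assms]] by meson
qed

lemma self_dual_pres_iff:
  assumes "consistent n a b c"
  shows "self_dual (pres n a b c) \<longleftrightarrow> a = b"
proof -
  let ?M = "nf_sgp n a b c" and ?P = "pres n a b c"
  have sg: "is_semigroup ?M" "is_semigroup (dual ?M)"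
    using is_semigroup_nf_sgp[OF assms] is_semigroup_dual by blast+
  have iso: "isomorphic ?M ?P" "isomorphic (dual ?M) (dual ?P)"
    using isomorphic_nf_sgp_pres[OF assms] isomorphic_dual by blast+
  have "self_dual ?P \<longleftrightarrow> isomorphic ?M (dual ?M)"
    unfolding self_dual_def using sg iso isomorphic_sym isomorphic_trans by meson
  also have "\<dots> \<longleftrightarrow> a = b"
    using isomorphic_nf_sgp_imp_eq[OF assms consistent_swap[OF assms]] isomorphic_refl
    unfolding dual_nf_sgp by metis
  finally show ?thesis .
qed

section \<open>Matching exponent triples with the labels of the list\<close>

primrec uv_exp :: "nat \<Rightarrow> label \<Rightarrow> nat" where
  "uv_exp n (label.H k) = k"
| "uv_exp n (label.J k) = k"
| "uv_exp n label.X = n div 2"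
| "uv_exp n label.N1 = n - 1"
| "uv_exp n label.N2 = n - 1"

primrec vu_exp :: "nat \<Rightarrow> label \<Rightarrow> nat" where
  "vu_exp n (label.H k) = k"
| "vu_exp n (label.J k) = k"
| "vu_exp n label.X = n div 2"
| "vu_exp n label.N1 = n - 2"
| "vu_exp n label.N2 = n - 2"

primrec sq_exp :: "nat \<Rightarrow> label \<Rightarrow> nat" where
  "sq_exp n (label.H k) = 2 * k - 2"
| "sq_exp n (label.J k) = n - 2"
| "sq_exp n label.X = n - 1"
| "sq_exp n label.N1 = n - 2"
| "sq_exp n label.N2 = n - 1"

lemma list_member_eq_pres: "list_member n i = pres n (uv_exp n i) (vu_exp n i) (sq_exp n i)"
  by (cases i) simp_all

lemma consistent_exps:
  assumes "5 \<le> n" "i \<in> labels n"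
  shows "consistent n (uv_exp n i) (vu_exp n i) (sq_exp n i)"
  using assms by (auto simp: labels_def consistent_def split: if_splits)

text \<open>Outside the H-case only c = n-2 and c capped to n-1 remain. If 2a > n, then 2a-2 is
  capped to n-1, so these give J_a and H_a. If 2a = n, then 2a-2 = n-2, so they give H_a and X. If
  \<open>a \<noteq> b\<close>, the two are n-1 and n-2 in some order, giving N_1 and N_2.\<close>

lemma ex_label:
  assumes "consistent n a b c"
  obtains i where "i \<in> labels n" "min (n - 1) (sq_exp n i) = min (n - 1) c"
    "uv_exp n i = a \<and> vu_exp n i = b \<or> uv_exp n i = b \<and> vu_exp n i = a"
proof -
  note bounds = consistent_bounds[OF assms]
  have c: "c = n - 2 \<or> n - 1 \<le> c" if "n \<le> c + 2"
    using that by linarith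
  consider "a = b" "c = 2 * a - 2" | "a = b" "n < 2 * a" "n \<le> c + 2"
    | "a = b" "n = 2 * a" "n \<le> c + 2" | "a \<noteq> b" "n \<le> a + 2" "n \<le> b + 2" "n \<le> c + 2"
    using assms unfolding consistent_def by linarith
  then show thesis
  proof cases
    case 1
    then show ?thesis
      using that[of "label.H a"] bounds by (simp add: labels_def)
  next
    case 2
    from c[OF 2(3)] show ?thesis
    proof
      assume "c = n - 2"
      then show ?thesis
        using that[of "label.J a"] bounds 2 by (simp add: labels_def)
    next
      assume "n - 1 \<le> c"
      moreover have "n - 1 \<le> 2 * a - 2"
        using 2(2) by linarith
      ultimately show ?thesis
        using that[of "label.H a"] bounds 2 by (simp add: labels_def)
    qed
  next
    case 3
    from c[OF 3(3)] show ?thesis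
    proof
      assume "c = n - 2"
      then show ?thesis
        using that[of "label.H a"] bounds 3 by (simp add: labels_def)
    next
      assume "n - 1 \<le> c"
      then show ?thesis
        using that[of "label.X"] bounds 3 by (simp add: labels_def)
    qed
  next
    case 4
    then have ab: "n - 1 = a \<and> n - 2 = b \<or> n - 1 = b \<and> n - 2 = a"
      using bounds by linarith
    from c[OF 4(4)] show ?thesis
    proof
      assume "c = n - 2"
      then show ?thesis
        using that[of "label.N1"] ab by (simp add: labels_def)
    next
      assume "n - 1 \<le> c"
      then show ?thesis
        using that[of "label.N2"] ab by (simp add: labels_def)
    qed
  qed
qed

text \<open>Distinct labels sharing their first two exponents differ in the capped square: n-2 for
  J_k against n-1 for H_k, n-2 for H_(n/2) against n-1 for X, and n-2 for N_1 against n-1 for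
  N_2.\<close>

lemma label_eqI:
  assumes "5 \<le> n" "i \<in> labels n" "j \<in> labels n"
    and "min (n - 1) (sq_exp n i) = min (n - 1) (sq_exp n j)"
    and "uv_exp n i = uv_exp n j \<and> vu_exp n i = vu_exp n j \<or>
      uv_exp n i = vu_exp n j \<and> vu_exp n i = uv_exp n j"
  shows "i = j"
proof -
  define m where "m = n - 2"
  have n: "n = Suc (Suc m)" and m: "3 \<le> m"
    using assms(1) by (simp_all add: m_def)
  have exps: "uv_exp n i = uv_exp n j \<and> vu_exp n i = vu_exp n j \<or>
      uv_exp n i = vu_exp n j \<and> vu_exp n i = uv_exp n j"
      "sq_exp n i = sq_exp n j \<or> Suc m \<le> sq_exp n i \<and> Suc m \<le> sq_exp n j"
    using assms(4,5) by (simp_all add: min_eq_min_iff n)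
  show ?thesis
    using exps assms(2,3) m unfolding n
    by (cases i; cases j; simp add: labels_def split: if_splits; linarith)
qed

theorem theorem3p2:
  fixes n :: nat
  assumes "n \<ge> 5"
  shows "complete_list n 1 (labels n) (list_member n) TYPE('a) \<and>
    (\<forall>i\<in>labels n. self_dual (list_member n i) \<longleftrightarrow> i \<noteq> label.N1 \<and> i \<noteq> label.N2)"
proof -
  note cons = consistent_exps[OF assms]
  have member: "nilpotent_of_order_coclass n 1 (list_member n i)" if "i \<in> labels n" for i
    using nilpotent_of_order_coclass_isomorphic[OF nilpotent_of_order_coclass_nf_sgp
        isomorphic_nf_sgp_pres] cons[OF that]
    unfolding list_member_eq_pres by blast
  have ex: "\<exists>i\<in>labels n. iso_or_anti_iso S (list_member n i)"
    if S: "nilpotent_of_order_coclass n 1 S" for S :: "'a sgp"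
  proof -
    interpret coclass_1_semigroup S n
      using S assms by unfold_locales (simp_all add: nilpotent_of_order_coclass_def nilpotent_def)
    obtain a b c where abc: "consistent n a b c" "isomorphic (nf_sgp n a b c) S"
      by (rule isomorphic_normal_form)
    then have iso: "isomorphic S (nf_sgp n a b c)"
      using isomorphic_sym is_semigroup_nf_sgp by blast
    obtain i where i: "i \<in> labels n" "min (n - 1) (sq_exp n i) = min (n - 1) c"
        "uv_exp n i = a \<and> vu_exp n i = b \<or> uv_exp n i = b \<and> vu_exp n i = a"
      using ex_label[OF abc(1)] .
    \<comment> \<open>\<open>c\<close> may differ from the listed exponent above the cap, which does
      not affect the multiplication.\<close>
    have "nf_sgp n a b c = nf_sgp n a b (sq_exp n i)"
      using i(2) by (rule nf_sgp_cong[symmetric])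
    then have "iso_or_anti_iso S (list_member n i)"
      unfolding list_member_eq_pres iso_or_anti_iso_pres_iff[OF cons[OF i(1)]]
      using iso i(3) by auto
    then show ?thesis
      using i(1) by blast
  qed
  have uniq: "i = j"
    if S: "nilpotent_of_order_coclass n 1 S" and ij: "i \<in> labels n" "j \<in> labels n"
      and iso: "iso_or_anti_iso S (list_member n i)" "iso_or_anti_iso S (list_member n j)"
    for S :: "'a sgp" and i j
  proof -
    have sg: "is_semigroup S"
      using S by (simp add: nilpotent_of_order_coclass_def nilpotent_def)
    \<comment> \<open>An anti-isomorphism with a list member is turned into an isomorphism with the
      normal form whose first two exponents are exchanged, so that \<open>S\<close> links two normal
      forms directly.\<close>
    have *: "\<exists>a b. isomorphic S (nf_sgp n a b (sq_exp n k)) \<and> consistent n a b (sq_exp n k) \<and>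
        (a = uv_exp n k \<and> b = vu_exp n k \<or> a = vu_exp n k \<and> b = uv_exp n k)"
      if "k \<in> labels n" "iso_or_anti_iso S (list_member n k)" for k
      using that cons[OF that(1)] consistent_swap[OF cons[OF that(1)]]
      unfolding list_member_eq_pres iso_or_anti_iso_pres_iff[OF cons[OF that(1)]] by blast
    obtain a b where ab: "isomorphic S (nf_sgp n a b (sq_exp n i))"
        "consistent n a b (sq_exp n i)"
        "a = uv_exp n i \<and> b = vu_exp n i \<or> a = vu_exp n i \<and> b = uv_exp n i"
      using *[OF ij(1) iso(1)] by blast
    obtain a' b' where ab': "isomorphic S (nf_sgp n a' b' (sq_exp n j))"
        "consistent n a' b' (sq_exp n j)"
        "a' = uv_exp n j \<and> b' = vu_exp n j \<or> a' = vu_exp n j \<and> b' = uv_exp n j"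
      using *[OF ij(2) iso(2)] by blast
    have "isomorphic (nf_sgp n a b (sq_exp n i)) (nf_sgp n a' b' (sq_exp n j))"
      using isomorphic_trans[OF isomorphic_sym[OF sg ab(1)] ab'(1)] .
    then have "a = a' \<and> b = b' \<and> min (n - 1) (sq_exp n i) = min (n - 1) (sq_exp n j)"
      by (rule isomorphic_nf_sgp_imp_eq[OF ab(2) ab'(2)])
    then show "i = j"
      using ab(3) ab'(3) by (intro label_eqI[OF assms ij]) auto
  qed
  have "complete_list n 1 (labels n) (list_member n) TYPE('a)"
    unfolding complete_list_def using member ex uniq by blast
  moreover have "self_dual (list_member n i) \<longleftrightarrow> i \<noteq> label.N1 \<and> i \<noteq> label.N2"
    if "i \<in> labels n" for i
    unfolding list_member_eq_pres self_dual_pres_iff[OF cons[OF that]]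
    using assms by (cases i) auto
  ultimately show ?thesis
    by blast
qed

end
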